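(* Let $R$ be a commutative Krasner $(m,n)$-hyperring with scalar identity $1_R$ and let $Q$ be a proper hyperideal of $R$. Then the following statements are equivalent: (1) $Q$ is an $n$-ary $J$-hyperideal of $R$. (2) For every $x\in R$ with $x\notin J_{(m,n)}(R)$ one has $Q=U_x$, where $U_x=\{y\in R \mid g(x,y,1_R^{(n-2)})\in Q\}$. (3) For all hyperideals $I_1,\dots,I_n$ of $R$ and every $1\le i\le n$, if $g(I_1^n)\subseteq Q$ and $I_i\nsubseteq J_{(m,n)}(R)$, then $g(I_1^{i-1},1_R,I_{i+1}^n)\subseteq Q$.
   Context: Notation: $m,n\ge 2$; $x_i^j$ denotes the sequence $x_i,\dots,x_j$ (empty if $j<i$), and $x^{(k)}$ denotes $x$ repeated $k$ times. An $m$-ary hyperoperation on $R$ is a map $f:R^m\to P^*(R)$ (nonempty subsets of $R$); operations and hyperoperations are extended to subsets by taking unions over elements (an element in an argument slot is identified with its singleton). Krasner $(m,n)$-hyperring $(R,f,g)$: (1) $(R,f)$ is a canonical $m$-ary hypergroup: $f$ is associative ($f(x_1^{i-1},f(x_i^{m+i-1}),x_{m+i}^{2m-1})$ is independent of $i$), every equation $b\in f(a_1^{i-1},x_i,a_{i+1}^m)$ is solvable in $x_i$, there is a unique $0\in R$ with $f(x,0^{(m-1)})=x$ for all $x$, each $x$ has a unique inverse $x^{-1}$ with $0\in f(x,x^{-1},0^{(m-2)})$, and $x\in f(x_1^m)$ implies $x_i\in f(x,x_1^{-1},\dots,x_{i-1}^{-1},x_{i+1}^{-1},\dots,x_m^{-1})$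 for all $i$; (2) $g:R^n\to R$ is an associative $n$-ary operation; (3) $g$ distributes over $f$ in each argument: $g(a_1^{i-1},f(x_1^m),a_{i+1}^n)=f(g(a_1^{i-1},x_1,a_{i+1}^n),\dots,g(a_1^{i-1},x_m,a_{i+1}^n))$; (4) $g(x_1^n)=0$ whenever some $x_i=0$. Commutative: $f$ and $g$ are invariant under permutations of their arguments. Scalar identity: $1_R\in R$ with $g(x,1_R^{(n-1)})=x$ for all $x$. A hyperideal is a nonempty $I\subseteq R$ such that $(I,f)$ is an $m$-ary subhypergroup ($f(x_1^m)\subseteq I$ for $x_1^m\in I$, and $b\in f(b_1^{i-1},x_i,b_{i+1}^m)$ has a solution $x_i\in I$ for all $b,b_j\in I$) and $g(x_1^{i-1},I,x_{i+1}^n)\subseteq I$ for all $x_j\in R$ and all $i$. It is proper if $I\ne R$. A proper hyperideal $M$ is maximal if $M\subseteq N\subseteq R$ with $N$ a hyperideal implies $N=M$ or $N=R$. $J_{(m,n)}(R)$ is the intersection of all maximal hyperideals of $R$ (and is $R$ if there are none). A proper hyperideal $Q$ is an $n$-ary $J$-hyperideal if for all $x_1^n\in R$ and all $1\le i\le n$: $g(x_1^n)\in Q$ and $x_i\notin J_{(m,n)}(R)$ imply $g(x_1^{i-1},1_R,x_{i+1}^n)\in Q$. *)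

theory Defs
  imports "HOL-Algebra.Congruence" "HOL-Library.Multiset"
begin

(* An m-ary (hyper)operation is a function on lists, of which only the values at lists of
   length m over the carrier matter. Argument positions are numbered from 0, and
   xs[i := y] is the argument list x_1, ..., y, ..., x_m with y in position i. *)
record 'a hyperring = "'a partial_object" +
  hadd :: "'a list \<Rightarrow> 'a set"
  hmul :: "'a list \<Rightarrow> 'a"

definition tuples :: "nat \<Rightarrow> 'a set \<Rightarrow> 'a list set" where
  "tuples k A = {xs. length xs = k \<and> set xs \<subseteq> A}"

definition is_hzero :: "nat \<Rightarrow> ('a, 'b) hyperring_scheme \<Rightarrow> 'a \<Rightarrow> bool" where
  "is_hzero m R e \<longleftrightarrow>
     e \<in> carrier R \<and> (\<forall>x\<in>carrier R. hadd R (x # replicate (m - 1) e) = {x})"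

definition hzero :: "nat \<Rightarrow> ('a, 'b) hyperring_scheme \<Rightarrow> 'a" where
  "hzero m R = (THE e. is_hzero m R e)"

definition is_hinv :: "nat \<Rightarrow> ('a, 'b) hyperring_scheme \<Rightarrow> 'a \<Rightarrow> 'a \<Rightarrow> bool" where
  "is_hinv m R x y \<longleftrightarrow>
     y \<in> carrier R \<and> hzero m R \<in> hadd R (x # y # replicate (m - 2) (hzero m R))"

definition hinv :: "nat \<Rightarrow> ('a, 'b) hyperring_scheme \<Rightarrow> 'a \<Rightarrow> 'a" where
  "hinv m R x = (THE y. is_hinv m R x y)"

definition canonical_hypergroup :: "nat \<Rightarrow> ('a, 'b) hyperring_scheme \<Rightarrow> bool" where
  "canonical_hypergroup m R \<longleftrightarrow>
     (\<forall>xs\<in>tuples m (carrier R). hadd R xs \<noteq> {} \<and> hadd R xs \<subseteq> carrier R) \<and>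
     (\<forall>xs\<in>tuples (2 * m - 1) (carrier R). \<forall>i<m. \<forall>j<m.
        (\<Union>y\<in>hadd R (take m (drop i xs)). hadd R (take i xs @ y # drop (i + m) xs)) =
        (\<Union>y\<in>hadd R (take m (drop j xs)). hadd R (take j xs @ y # drop (j + m) xs))) \<and>
     (\<forall>as\<in>tuples m (carrier R). \<forall>b\<in>carrier R. \<forall>i<m.
        \<exists>x\<in>carrier R. b \<in> hadd R (as[i := x])) \<and>
     (\<exists>!e. is_hzero m R e) \<and>
     (\<forall>x\<in>carrier R. \<exists>!y. is_hinv m R x y) \<and>
     (\<forall>xs\<in>tuples m (carrier R). \<forall>x\<in>hadd R xs. \<forall>i<m.
        xs ! i \<in> hadd R (x # map (hinv m R) (take i xs) @ map (hinv m R) (drop (Suc i) xs)))"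

definition krasner_hyperring :: "nat \<Rightarrow> nat \<Rightarrow> ('a, 'b) hyperring_scheme \<Rightarrow> bool" where
  "krasner_hyperring m n R \<longleftrightarrow>
     canonical_hypergroup m R \<and>
     (\<forall>xs\<in>tuples n (carrier R). hmul R xs \<in> carrier R) \<and>
     (\<forall>xs\<in>tuples (2 * n - 1) (carrier R). \<forall>i<n. \<forall>j<n.
        hmul R (take i xs @ hmul R (take n (drop i xs)) # drop (i + n) xs) =
        hmul R (take j xs @ hmul R (take n (drop j xs)) # drop (j + n) xs)) \<and>
     (\<forall>as\<in>tuples n (carrier R). \<forall>xs\<in>tuples m (carrier R). \<forall>i<n.
        (\<lambda>y. hmul R (as[i := y])) ` hadd R xs = hadd R (map (\<lambda>x. hmul R (as[i := x])) xs)) \<and>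
     (\<forall>xs\<in>tuples n (carrier R). hzero m R \<in> set xs \<longrightarrow> hmul R xs = hzero m R)"

definition hcommutative :: "nat \<Rightarrow> nat \<Rightarrow> ('a, 'b) hyperring_scheme \<Rightarrow> bool" where
  "hcommutative m n R \<longleftrightarrow>
     (\<forall>xs\<in>tuples m (carrier R). \<forall>ys. mset ys = mset xs \<longrightarrow> hadd R ys = hadd R xs) \<and>
     (\<forall>xs\<in>tuples n (carrier R). \<forall>ys. mset ys = mset xs \<longrightarrow> hmul R ys = hmul R xs)"

definition scalar_identity :: "nat \<Rightarrow> ('a, 'b) hyperring_scheme \<Rightarrow> 'a \<Rightarrow> bool" where
  "scalar_identity n R u \<longleftrightarrow>
     u \<in> carrier R \<and> (\<forall>x\<in>carrier R. hmul R (x # replicate (n - 1) u) = x)"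

definition hyperideal :: "nat \<Rightarrow> nat \<Rightarrow> ('a, 'b) hyperring_scheme \<Rightarrow> 'a set \<Rightarrow> bool" where
  "hyperideal m n R I \<longleftrightarrow>
     I \<noteq> {} \<and> I \<subseteq> carrier R \<and>
     (\<forall>xs\<in>tuples m I. hadd R xs \<subseteq> I) \<and>
     (\<forall>bs\<in>tuples m I. \<forall>b\<in>I. \<forall>i<m. \<exists>x\<in>I. b \<in> hadd R (bs[i := x])) \<and>
     (\<forall>xs\<in>tuples n (carrier R). \<forall>i<n. \<forall>y\<in>I. hmul R (xs[i := y]) \<in> I)"

definition proper_hyperideal :: "nat \<Rightarrow> nat \<Rightarrow> ('a, 'b) hyperring_scheme \<Rightarrow> 'a set \<Rightarrow> bool" where
  "proper_hyperideal m n R I \<longleftrightarrow> hyperideal m n R I \<and> I \<noteq> carrier R"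

definition maximal_hyperideal :: "nat \<Rightarrow> nat \<Rightarrow> ('a, 'b) hyperring_scheme \<Rightarrow> 'a set \<Rightarrow> bool" where
  "maximal_hyperideal m n R M \<longleftrightarrow>
     proper_hyperideal m n R M \<and>
     (\<forall>N. hyperideal m n R N \<and> M \<subseteq> N \<longrightarrow> N = M \<or> N = carrier R)"

(* Intersecting with the carrier only matters when there is no maximal hyperideal. *)
definition hjacobson :: "nat \<Rightarrow> nat \<Rightarrow> ('a, 'b) hyperring_scheme \<Rightarrow> 'a set" where
  "hjacobson m n R = carrier R \<inter> \<Inter>{M. maximal_hyperideal m n R M}"

definition J_hyperideal ::
    "nat \<Rightarrow> nat \<Rightarrow> ('a, 'b) hyperring_scheme \<Rightarrow> 'a \<Rightarrow> 'a set \<Rightarrow> bool" where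
  "J_hyperideal m n R u Q \<longleftrightarrow>
     proper_hyperideal m n R Q \<and>
     (\<forall>xs\<in>tuples n (carrier R). \<forall>i<n.
        hmul R xs \<in> Q \<and> xs ! i \<notin> hjacobson m n R \<longrightarrow> hmul R (xs[i := u]) \<in> Q)"

(* The extension of hmul to subsets; listset [A_1, ..., A_n] is the set of lists
   [a_1, ..., a_n] with every a_k in A_k. *)
definition hmul_sets :: "('a, 'b) hyperring_scheme \<Rightarrow> 'a set list \<Rightarrow> 'a set" where
  "hmul_sets R As = hmul R ` listset As"

end

theory Submission imports Defs begin

text \<open>
  Filling all but two argument places of the \<open>n\<close>-ary product with the scalar identity \<open>u\<close> leaves
  a binary product \<open>x \<odot> y\<close>, which makes the carrier a commutative monoid with unit \<open>u\<close>. No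
  information is lost in this passage: an arbitrary entry splits off an \<open>n\<close>-ary product,
  \<open>hmul R (xs[i := y]) = y \<odot> hmul R (xs[i := u])\<close> (lemma \<open>hmul_split\<close>). Hence all three conditions
  of the theorem are forms of one statement about \<open>\<odot>\<close>: if \<open>x\<close> is outside the Jacobson radical
  and \<open>x \<odot> y \<in> Q\<close>, then \<open>y \<in> Q\<close>.

  With \<open>x = xs ! i\<close> and \<open>y = hmul R (xs[i := u])\<close> this is the condition defining a
  \<open>J\<close>-hyperideal, and it is the inclusion \<open>U\<^sub>x \<subseteq> Q\<close>; the other inclusion holds because \<open>Q\<close>
  absorbs products. The condition on hyperideals follows by choosing \<open>x\<close> in the \<open>i\<close>-th hyperideal
  and outside the radical. Conversely, it is applied to the principal hyperideals generated by
  \<open>x\<close>, \<open>y\<close>, \<open>u\<close>, ..., \<open>u\<close>, whose product lies in \<open>Q\<close> as soon as \<open>x \<odot> y\<close> does. That the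
  multiples of an element form a hyperideal at all (lemma \<open>hyperideal_principal\<close>) is where
  distributivity enters.
\<close>

section \<open>The binary product with padding by the scalar identity\<close>

lemma in_listset_conv:
  "xs \<in> listset As \<longleftrightarrow> length xs = length As \<and> (\<forall>k<length As. xs ! k \<in> As ! k)"
proof (induction As arbitrary: xs)
  case (Cons A As)
  then show ?case
    by (cases xs) (auto simp: set_Cons_def less_Suc_eq_0_disj)
qed auto

locale unital_comm_hyperring =
  fixes R :: "('a, 'b) hyperring_scheme" and m n :: nat and u :: 'a
  assumes n_ge_2: "n \<ge> 2"
    and krasner: "krasner_hyperring m n R"
    and comm: "hcommutative m n R"
    and identity: "scalar_identity n R u"
begin

definition bmul :: "'a \<Rightarrow> 'a \<Rightarrow> 'a" (infixl "\<odot>" 70) where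
  "x \<odot> y = hmul R (x # y # replicate (n - 2) u)"

lemma u_closed [simp]: "u \<in> carrier R"
  using identity by (simp add: scalar_identity_def)

lemma hmul_closed: "length xs = n \<Longrightarrow> set xs \<subseteq> carrier R \<Longrightarrow> hmul R xs \<in> carrier R"
  using krasner by (simp add: krasner_hyperring_def tuples_def)

lemma hmul_mset_cong:
  "length xs = n \<Longrightarrow> set xs \<subseteq> carrier R \<Longrightarrow> mset ys = mset xs \<Longrightarrow> hmul R ys = hmul R xs"
  using comm unfolding hcommutative_def tuples_def by blast

lemma bmul_closed [simp]: "x \<in> carrier R \<Longrightarrow> y \<in> carrier R \<Longrightarrow> x \<odot> y \<in> carrier R"
  unfolding bmul_def using n_ge_2 by (intro hmul_closed) auto

lemma bmul_comm: "x \<in> carrier R \<Longrightarrow> y \<in> carrier R \<Longrightarrow> x \<odot> y = y \<odot> x"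
  unfolding bmul_def using n_ge_2 by (intro hmul_mset_cong) auto

lemma bmul_u [simp]:
  assumes "x \<in> carrier R"
  shows "x \<odot> u = x"
proof -
  have "n - 1 = Suc (n - 2)"
    using n_ge_2 by simp
  then have "u # replicate (n - 2) u = replicate (n - 1) u"
    by simp
  then show ?thesis
    using identity assms by (simp add: bmul_def scalar_identity_def)
qed

lemma u_bmul [simp]: "x \<in> carrier R \<Longrightarrow> u \<odot> x = x"
  using bmul_comm[of u x] by simp

text \<open>
  The case of \<open>n\<close>-ary associativity that moves the inner product from the first place to the
  second. It yields both the associativity of \<open>\<odot>\<close> and the reduction of \<open>hmul\<close> to \<open>\<odot>\<close>.
\<close>

lemma hmul_assoc_first_second:
  assumes "a \<in> carrier R" "b \<in> carrier R" "set xs \<subseteq> carrier R" "set ys \<subseteq> carrier R"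
    and "length xs = n - 1" "length ys = n - 2"
  shows "hmul R (hmul R (a # xs) # b # ys) = hmul R (a # hmul R (xs @ [b]) # ys)"
proof -
  let ?l = "a # xs @ b # ys"
  have "?l \<in> tuples (2 * n - 1) (carrier R)"
    using assms n_ge_2 by (auto simp: tuples_def)
  moreover have "0 < n" "1 < n"
    using n_ge_2 by auto
  ultimately have "hmul R (take 0 ?l @ hmul R (take n (drop 0 ?l)) # drop (0 + n) ?l) =
      hmul R (take 1 ?l @ hmul R (take n (drop 1 ?l)) # drop (1 + n) ?l)"
    using krasner unfolding krasner_hyperring_def by blast
  moreover obtain k where "n = Suc (Suc k)"
    using n_ge_2 by (metis add_2_eq_Suc le_Suc_ex)
  ultimately show ?thesis
    using assms by simp
qed

lemma hmul_Cons:
  assumes "a \<in> carrier R" "set xs \<subseteq> carrier R" "length xs = n - 1"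
  shows "hmul R (a # xs) = a \<odot> hmul R (xs @ [u])"
proof -
  have "hmul R (a # xs) = hmul R (a # xs) \<odot> u"
    using assms n_ge_2 by (intro bmul_u[symmetric] hmul_closed) auto
  also have "\<dots> = a \<odot> hmul R (xs @ [u])"
    unfolding bmul_def using assms by (intro hmul_assoc_first_second) auto
  finally show ?thesis .
qed

lemma bmul_assoc:
  assumes "a \<in> carrier R" "b \<in> carrier R" "c \<in> carrier R"
  shows "a \<odot> b \<odot> c = a \<odot> (b \<odot> c)"
proof -
  have "a \<odot> b \<odot> c = hmul R (a # hmul R ((b # replicate (n - 2) u) @ [c]) # replicate (n - 2) u)"
    unfolding bmul_def using assms n_ge_2 by (intro hmul_assoc_first_second) auto
  also have "hmul R ((b # replicate (n - 2) u) @ [c]) = b \<odot> c"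
    unfolding bmul_def using assms n_ge_2 by (intro hmul_mset_cong) auto
  finally show ?thesis
    by (simp add: bmul_def[of a])
qed

lemma bmul_left_comm:
  "a \<in> carrier R \<Longrightarrow> b \<in> carrier R \<Longrightarrow> c \<in> carrier R \<Longrightarrow> a \<odot> (b \<odot> c) = b \<odot> (a \<odot> c)"
  by (metis bmul_assoc bmul_comm)

lemmas bmul_ac = bmul_assoc bmul_comm bmul_left_comm

text \<open>
  By commutativity the \<open>i\<close>-th entry may be taken as the first, so \<open>hmul R (xs[i := y]) = y \<odot> c\<close>
  with a \<open>c\<close> that depends only on the other entries; putting \<open>y = u\<close> identifies \<open>c\<close>.
\<close>

lemma hmul_split:
  assumes "set xs \<subseteq> carrier R" "length xs = n" "i < n" "y \<in> carrier R"
  shows "hmul R (xs[i := y]) = y \<odot> hmul R (xs[i := u])"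
proof -
  define zs where "zs = take i xs @ drop (Suc i) xs"
  have zs: "set zs \<subseteq> carrier R" "length zs = n - 1"
    using assms set_take_subset[of i xs] set_drop_subset[of "Suc i" xs]
    by (auto simp: zs_def)
  have split_front: "hmul R (xs[i := a]) = a \<odot> hmul R (zs @ [u])" if "a \<in> carrier R" for a
  proof -
    have "hmul R (xs[i := a]) = hmul R (a # zs)"
      using assms zs that n_ge_2
      by (intro hmul_mset_cong) (auto simp: upd_conv_take_nth_drop zs_def)
    then show ?thesis
      using hmul_Cons zs that by simp
  qed
  have "hmul R (zs @ [u]) \<in> carrier R"
    using zs n_ge_2 by (intro hmul_closed) auto
  then show ?thesis
    using split_front assms by simp
qed

lemma hmul_split_nth:
  assumes "set xs \<subseteq> carrier R" "length xs = n" "i < n"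
  shows "hmul R xs = xs ! i \<odot> hmul R (xs[i := u])"
  using hmul_split[of xs i "xs ! i"] assms by (metis list_update_id nth_mem subsetD)

lemma hmul_update_closed:
  assumes "set xs \<subseteq> carrier R" "length xs = n" "y \<in> carrier R"
  shows "hmul R (xs[i := y]) \<in> carrier R"
  using assms set_update_subset_insert[of xs i y] by (intro hmul_closed) auto

section \<open>Hyperideals and principal hyperideals\<close>

lemma hyperideal_bmul:
  assumes "hyperideal m n R I" "x \<in> I" "r \<in> carrier R"
  shows "r \<odot> x \<in> I"
proof -
  have "(r # u # replicate (n - 2) u)[1 := x] = r # x # replicate (n - 2) u"
    by simp
  moreover have "r # u # replicate (n - 2) u \<in> tuples n (carrier R)"
    using assms(3) n_ge_2 by (auto simp: tuples_def)
  moreover have "1 < n"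
    using n_ge_2 by simp
  ultimately show ?thesis
    using assms(1,2) unfolding hyperideal_def bmul_def by metis
qed

lemma hadd_bmul:
  assumes "rs \<in> tuples m (carrier R)" "x \<in> carrier R"
  shows "hadd R (map (\<lambda>r. r \<odot> x) rs) = (\<lambda>r. r \<odot> x) ` hadd R rs"
proof -
  let ?as = "u # x # replicate (n - 2) u"
  have "?as \<in> tuples n (carrier R)" "0 < n"
    using assms n_ge_2 by (auto simp: tuples_def)
  then have "(\<lambda>y. hmul R (?as[0 := y])) ` hadd R rs = hadd R (map (\<lambda>y. hmul R (?as[0 := y])) rs)"
    using krasner assms(1) unfolding krasner_hyperring_def by blast
  then show ?thesis
    by (simp add: bmul_def)
qed

definition principal :: "'a \<Rightarrow> 'a set" where
  "principal x = (\<lambda>r. r \<odot> x) ` carrier R"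

lemma principal_self: "x \<in> carrier R \<Longrightarrow> x \<in> principal x"
  unfolding principal_def by (rule image_eqI[of _ _ u]) auto

lemma tuples_principalE:
  assumes "xs \<in> tuples k (principal x)"
  obtains rs where "rs \<in> tuples k (carrier R)" "xs = map (\<lambda>r. r \<odot> x) rs"
proof -
  have "xs \<in> lists (principal x)"
    using assms by (auto simp: tuples_def in_lists_conv_set)
  also have "\<dots> = map (\<lambda>r. r \<odot> x) ` lists (carrier R)"
    by (simp only: principal_def lists_image)
  finally obtain rs where "rs \<in> lists (carrier R)" "xs = map (\<lambda>r. r \<odot> x) rs"
    by blast
  then show ?thesis
    using assms that[of rs] by (simp add: tuples_def in_lists_conv_set subset_iff)
qed

text \<open>
  By distributivity the map \<open>r \<mapsto> r \<odot> x\<close> carries the hyperaddition of \<open>R\<close> to that of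
  \<open>principal x\<close>. Closure under \<open>hadd\<close> and the solvability of equations are therefore inherited
  from \<open>R\<close>: the coefficients of the multiples of \<open>x\<close> form an equation in \<open>R\<close>, and a solution of
  it, multiplied by \<open>x\<close>, solves the given one.
\<close>

lemma hyperideal_principal:
  assumes x: "x \<in> carrier R"
  shows "hyperideal m n R (principal x)"
  unfolding hyperideal_def
proof (intro conjI ballI allI impI)
  have hypergroup: "canonical_hypergroup m R"
    using krasner by (simp add: krasner_hyperring_def)
  show "principal x \<noteq> {}"
    using principal_self[OF x] by blast
  show "principal x \<subseteq> carrier R"
    using x by (auto simp: principal_def)
  show "hadd R xs \<subseteq> principal x" if xs: "xs \<in> tuples m (principal x)" for xs
  proof -
    obtain rs where rs: "rs \<in> tuples m (carrier R)" "xs = map (\<lambda>r. r \<odot> x) rs"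
      using xs by (rule tuples_principalE)
    moreover have "hadd R rs \<subseteq> carrier R"
      using hypergroup rs(1) unfolding canonical_hypergroup_def by blast
    ultimately show ?thesis
      using x by (auto simp: hadd_bmul principal_def)
  qed
  show "\<exists>z\<in>principal x. b \<in> hadd R (bs[i := z])"
    if bs: "bs \<in> tuples m (principal x)" and b: "b \<in> principal x" and i: "i < m" for bs b i
  proof -
    obtain rs where rs: "rs \<in> tuples m (carrier R)" "bs = map (\<lambda>r. r \<odot> x) rs"
      using bs by (rule tuples_principalE)
    obtain s where s: "s \<in> carrier R" "b = s \<odot> x"
      using b by (auto simp: principal_def)
    have "\<forall>as\<in>tuples m (carrier R). \<forall>b\<in>carrier R. \<forall>i<m. \<exists>z\<in>carrier R. b \<in> hadd R (as[i := z])"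
      using hypergroup unfolding canonical_hypergroup_def by (elim conjE)
    then obtain t where t: "t \<in> carrier R" "s \<in> hadd R (rs[i := t])"
      using rs(1) s(1) i by blast
    have "rs[i := t] \<in> tuples m (carrier R)"
      using rs(1) t(1) set_update_subset_insert[of rs i t] by (auto simp: tuples_def)
    then have "b \<in> hadd R (map (\<lambda>r. r \<odot> x) (rs[i := t]))"
      using hadd_bmul[of "rs[i := t]" x] x t(2) s(2) by simp
    then have "b \<in> hadd R (bs[i := t \<odot> x])"
      by (simp add: map_update rs(2))
    then show ?thesis
      using t(1) by (auto simp: principal_def)
  qed
  show "hmul R (xs[i := y]) \<in> principal x"
    if xs: "xs \<in> tuples n (carrier R)" and i: "i < n" and y: "y \<in> principal x" for xs i y
  proof -
    obtain r where r: "r \<in> carrier R" "y = r \<odot> x"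
      using y by (auto simp: principal_def)
    define c where "c = hmul R (xs[i := u])"
    have c: "c \<in> carrier R"
      unfolding c_def using xs by (intro hmul_update_closed) (auto simp: tuples_def)
    have "hmul R (xs[i := y]) = y \<odot> c"
      unfolding c_def using xs i r x by (intro hmul_split) (auto simp: tuples_def)
    also have "\<dots> = r \<odot> c \<odot> x"
      using r x c by (simp add: bmul_ac)
    finally show ?thesis
      using r c by (auto simp: principal_def)
  qed
qed

section \<open>Cancellation outside a set\<close>

text \<open>
  The binary condition with which all three conditions of the theorem are compared; there \<open>J\<close> is
  the Jacobson radical.
\<close>

definition cancels_outside :: "'a set \<Rightarrow> 'a set \<Rightarrow> bool" where
  "cancels_outside J Q \<longleftrightarrow>
     (\<forall>x\<in>carrier R. \<forall>y\<in>carrier R. x \<notin> J \<longrightarrow> x \<odot> y \<in> Q \<longrightarrow> y \<in> Q)"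

lemma cancels_outside_iff_nary:
  "cancels_outside J Q \<longleftrightarrow>
     (\<forall>xs\<in>tuples n (carrier R). \<forall>i<n. hmul R xs \<in> Q \<and> xs ! i \<notin> J \<longrightarrow> hmul R (xs[i := u]) \<in> Q)"
  (is "_ \<longleftrightarrow> ?nary")
proof
  assume cancel: "cancels_outside J Q"
  show ?nary
  proof (intro ballI allI impI)
    fix xs i
    assume xs: "xs \<in> tuples n (carrier R)" and i: "i < n" and Q: "hmul R xs \<in> Q \<and> xs ! i \<notin> J"
    have "xs ! i \<in> carrier R"
      using xs i by (auto simp: tuples_def)
    moreover have "hmul R (xs[i := u]) \<in> carrier R"
      using xs by (intro hmul_update_closed) (auto simp: tuples_def)
    moreover have "hmul R xs = xs ! i \<odot> hmul R (xs[i := u])"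
      using xs i by (intro hmul_split_nth) (auto simp: tuples_def)
    ultimately show "hmul R (xs[i := u]) \<in> Q"
      using cancel Q by (simp add: cancels_outside_def)
  qed
next
  assume nary: ?nary
  show "cancels_outside J Q"
    unfolding cancels_outside_def
  proof (intro ballI impI)
    fix x y
    assume x: "x \<in> carrier R" and y: "y \<in> carrier R" and "x \<notin> J" and "x \<odot> y \<in> Q"
    let ?xs = "x # y # replicate (n - 2) u"
    have "?xs \<in> tuples n (carrier R)"
      using x y n_ge_2 by (auto simp: tuples_def)
    moreover have "hmul R ?xs \<in> Q" "?xs ! 0 \<notin> J" "0 < n"
      using \<open>x \<odot> y \<in> Q\<close> \<open>x \<notin> J\<close> n_ge_2 by (simp_all add: bmul_def)
    ultimately have "hmul R (?xs[0 := u]) \<in> Q"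
      using nary by blast
    then have "u \<odot> y \<in> Q"
      by (simp add: bmul_def)
    then show "y \<in> Q"
      using y by simp
  qed
qed

lemma cancels_outside_iff_residuals:
  assumes Q: "hyperideal m n R Q"
  shows "cancels_outside J Q \<longleftrightarrow>
     (\<forall>x\<in>carrier R. x \<notin> J \<longrightarrow> Q = {y \<in> carrier R. x \<odot> y \<in> Q})"
proof -
  have "Q \<subseteq> {y \<in> carrier R. x \<odot> y \<in> Q}" if "x \<in> carrier R" for x
    using Q that hyperideal_bmul by (auto simp: hyperideal_def)
  then show ?thesis
    unfolding cancels_outside_def by blast
qed

text \<open>
  Both directions rest on \<open>hmul_split\<close>. From left to right, a product of elements with \<open>u\<close> at
  place \<open>i\<close> turns into \<open>x \<odot> _\<close> when \<open>u\<close> is replaced by some \<open>x\<close> of the \<open>i\<close>-th hyperideal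
  outside \<open>J\<close>. From right to left, every product of elements of the principal hyperideals of
  \<open>x\<close>, \<open>y\<close>, \<open>u\<close>, ..., \<open>u\<close> is a multiple of \<open>x \<odot> y\<close>, and replacing the first of these
  hyperideals by \<open>{u}\<close> leaves a product that contains \<open>u \<odot> y = y\<close>.
\<close>

lemma cancels_outside_iff_hyperideals:
  assumes Q: "hyperideal m n R Q"
  shows "cancels_outside J Q \<longleftrightarrow>
     (\<forall>Is. length Is = n \<and> (\<forall>I\<in>set Is. hyperideal m n R I) \<longrightarrow>
        (\<forall>i<n. hmul_sets R Is \<subseteq> Q \<and> \<not> Is ! i \<subseteq> J \<longrightarrow> hmul_sets R (Is[i := {u}]) \<subseteq> Q))"
  (is "_ \<longleftrightarrow> ?ideals")
proof
  assume cancel: "cancels_outside J Q"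
  show ?ideals
  proof (intro allI impI)
    fix Is i
    assume Is: "length Is = n \<and> (\<forall>I\<in>set Is. hyperideal m n R I)" and i: "i < n"
      and prod: "hmul_sets R Is \<subseteq> Q \<and> \<not> Is ! i \<subseteq> J"
    obtain x where x: "x \<in> Is ! i" "x \<notin> J"
      using prod by blast
    have in_carrier: "Is ! k \<subseteq> carrier R" if "k < n" for k
      using Is that nth_mem[of k Is] by (auto simp: hyperideal_def)
    show "hmul_sets R (Is[i := {u}]) \<subseteq> Q"
      unfolding hmul_sets_def
    proof (rule image_subsetI)
      fix bs
      assume "bs \<in> listset (Is[i := {u}])"
      then have bs: "length bs = n" "\<And>k. k < n \<Longrightarrow> bs ! k \<in> Is[i := {u}] ! k"
        using Is by (auto simp: in_listset_conv)
      \<comment> \<open>The \<open>i\<close>-th factor is \<open>{u}\<close>, so \<open>bs\<close> already is its own update by \<open>u\<close>.\<close>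
      have bs_u: "bs[i := u] = bs"
        using bs(2)[OF i] Is i by (metis list_update_id nth_list_update_eq singletonD)
      have bs_carrier: "set bs \<subseteq> carrier R"
      proof
        fix b
        assume "b \<in> set bs"
        then obtain k where "k < n" "b = bs ! k"
          using bs(1) by (auto simp: in_set_conv_nth)
        then show "b \<in> carrier R"
          using bs(2)[of k] in_carrier[of k] Is by (cases "k = i") auto
      qed
      have "bs[i := x] ! k \<in> Is ! k" if "k < n" for k
        using bs(1) bs(2)[OF that] x(1) i that Is by (cases "k = i") auto
      then have "bs[i := x] \<in> listset Is"
        using bs(1) Is by (simp add: in_listset_conv)
      then have "hmul R (bs[i := x]) \<in> Q"
        using prod by (auto simp: hmul_sets_def)
      moreover have x_carrier: "x \<in> carrier R"
        using x(1) in_carrier[OF i] by blast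
      ultimately have "x \<odot> hmul R bs \<in> Q"
        using hmul_split[of bs i x] bs_carrier bs(1) i bs_u by simp
      then show "hmul R bs \<in> Q"
        using cancel x(2) x_carrier hmul_closed[OF bs(1) bs_carrier]
        by (simp add: cancels_outside_def)
    qed
  qed
next
  assume ideals: ?ideals
  show "cancels_outside J Q"
    unfolding cancels_outside_def
  proof (intro ballI impI)
    fix x y
    assume x: "x \<in> carrier R" and y: "y \<in> carrier R" and "x \<notin> J" and xy: "x \<odot> y \<in> Q"
    let ?Us = "replicate (n - 2) (principal u)"
    let ?Is = "principal x # principal y # ?Us"
    have Is: "length ?Is = n \<and> (\<forall>I\<in>set ?Is. hyperideal m n R I)"
      using n_ge_2 x y by (auto intro: hyperideal_principal)
    have "hmul_sets R ?Is \<subseteq> Q"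
      unfolding hmul_sets_def
    proof (rule image_subsetI)
      fix as
      assume "as \<in> listset ?Is"
      then obtain a b zs where as: "as = a # b # zs" "a \<in> principal x" "b \<in> principal y"
        and zs: "zs \<in> listset ?Us"
        by (auto simp: set_Cons_def)
      have len: "length zs = n - 2"
        using zs by (auto simp: in_listset_conv)
      have zs_carrier: "set zs \<subseteq> carrier R"
        using zs by (auto simp: in_listset_conv in_set_conv_nth principal_def)
      obtain r s where rs: "r \<in> carrier R" "a = r \<odot> x" "s \<in> carrier R" "b = s \<odot> y"
        using as by (auto simp: principal_def)
      define c where "c = hmul R (u # u # zs)"
      have c: "c \<in> carrier R"
        unfolding c_def using len zs_carrier n_ge_2 by (intro hmul_closed) auto
      have "hmul R (a # b # zs) = a \<odot> hmul R (u # b # zs)"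
        using hmul_split[of "a # b # zs" 0 a] len zs_carrier n_ge_2 rs x y by simp
      also have "hmul R (u # b # zs) = b \<odot> c"
        unfolding c_def using hmul_split[of "u # b # zs" 1 b] len zs_carrier n_ge_2 rs x y by simp
      also have "a \<odot> (b \<odot> c) = (r \<odot> s \<odot> c) \<odot> (x \<odot> y)"
        using rs x y c by (simp add: bmul_ac)
      finally show "hmul R as \<in> Q"
        using as(1) hyperideal_bmul[OF Q xy] rs c by simp
    qed
    moreover have "\<not> ?Is ! 0 \<subseteq> J" "0 < n"
      using principal_self[OF x] \<open>x \<notin> J\<close> n_ge_2 by auto
    ultimately have "hmul_sets R (?Is[0 := {u}]) \<subseteq> Q"
      using ideals Is by blast
    moreover have "u # y # replicate (n - 2) u \<in> listset (?Is[0 := {u}])"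
      using principal_self y by (auto simp: set_Cons_def in_listset_conv)
    ultimately have "u \<odot> y \<in> Q"
      by (auto simp: hmul_sets_def bmul_def)
    then show "y \<in> Q"
      using y by simp
  qed
qed

end

section \<open>Characterizations of J-hyperideals\<close>

theorem theorem3p7:
  fixes R :: "('a, 'b) hyperring_scheme" and m n :: nat and u :: 'a and Q :: "'a set"
  assumes "m \<ge> 2" and "n \<ge> 2"
    and "krasner_hyperring m n R"
    and "hcommutative m n R"
    and "scalar_identity n R u"
    and "proper_hyperideal m n R Q"
  defines "P1 \<equiv> J_hyperideal m n R u Q"
    and "P2 \<equiv> (\<forall>x\<in>carrier R. x \<notin> hjacobson m n R \<longrightarrow>
                 Q = {y \<in> carrier R. hmul R (x # y # replicate (n - 2) u) \<in> Q})"
    and "P3 \<equiv> (\<forall>Is. length Is = n \<and> (\<forall>I\<in>set Is. hyperideal m n R I) \<longrightarrow>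
                 (\<forall>i<n. hmul_sets R Is \<subseteq> Q \<and> \<not> Is ! i \<subseteq> hjacobson m n R \<longrightarrow>
                    hmul_sets R (Is[i := {u}]) \<subseteq> Q))"
  shows "(P1 \<longleftrightarrow> P2) \<and> (P2 \<longleftrightarrow> P3)"
proof -
  interpret unital_comm_hyperring R m n u
    using assms by unfold_locales
  have Q: "hyperideal m n R Q"
    using assms(6) by (simp add: proper_hyperideal_def)
  let ?cancel = "cancels_outside (hjacobson m n R) Q"
  have "P1 \<longleftrightarrow> ?cancel"
    unfolding P1_def J_hyperideal_def cancels_outside_iff_nary using assms(6) by simp
  moreover have "P2 \<longleftrightarrow> ?cancel"
    unfolding P2_def cancels_outside_iff_residuals[OF Q] bmul_def ..
  moreover have "P3 \<longleftrightarrow> ?cancel"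
    unfolding P3_def cancels_outside_iff_hyperideals[OF Q] ..
  ultimately show ?thesis
    by simp
qed

end
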